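(* Let $n\ge1$, $\hbar>0$, $h=2\pi\hbar$, and let $X,Y$ be real symmetric $n\times n$ matrices with $X$ positive definite. Let $$\mathcal{W}_{\mathrm F}=\{z\in\mathbb{R}^{2n}: M_{\mathrm F}z\cdot z\le\hbar\},\qquad M_{\mathrm F}=\frac{1}{\operatorname{Tr}X}\begin{pmatrix} X^2+Y^2 & Y \\ Y & I \end{pmatrix}$$ be the Fermi ellipsoid of the squeezed coherent state $\Phi^\hbar_{X,Y}$. (i) There exist (linear) symplectic coordinates in which $\mathcal{W}_{\mathrm F}$ is represented by the inequality $$Xx\cdot x+Xp\cdot p\le\hbar\operatorname{Tr}X,$$ and there exist (linear) symplectic coordinates in which it is represented by the inequality $$\sum_{j=1}^n\lambda_j(x_j^2+p_j^2)\le\hbar\operatorname{Tr}X,$$ where $\lambda_1,\dots,\lambda_n$ are the eigenvalues of $X$. (ii) For every symplectic capacity $c$ on $\mathbb{R}^{2n}$, $$c(\mathcal{W}_{\mathrm F})=\frac{\pi\operatorname{Tr}X}{\lambda_{\max}}\hbar\ge\frac12h,$$ where $\lambda_{\max}$ is the largest eigenvalue of $X$, and $$\frac12h\le c(\mathcal{W}_{\mathrm F})\le\frac{nh}{2}.$$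
   Context: Phase space is $\mathbb{R}^{2n}$ with points $z=(x,p)$, $x,p\in\mathbb{R}^n$, the dot is the Euclidean scalar product, $J=\begin{pmatrix} 0 & I \\ -I & 0 \end{pmatrix}$ and $\operatorname{Sp}(2n,\mathbb{R})=\{S:S^TJS=J\}$. A set $\mathcal W$ is represented by an inequality in linear symplectic coordinates if there is $S\in\operatorname{Sp}(2n,\mathbb{R})$ such that $S(\mathcal W)$ is the set of $z=(x,p)$ satisfying that inequality. The squeezed coherent state is $\Phi^\hbar_{X,Y}(x)=(\pi\hbar)^{-n/4}(\det X)^{1/4}e^{-\frac1{2\hbar}(X+iY)x\cdot x}$. For a wavefunction $\Psi=Re^{i\Phi/\hbar}$ ($R\ge0$, $\Phi$ real), Fermi's function is $g_{\mathrm F}(x,p)=(p-\nabla_x\Phi)^2+\hbar^2\frac{\nabla_x^2R}{R}$; for $\Psi=\Phi^\hbar_{X,Y}$ it equals $(p+Yx)^2+X^2x\cdot x-\hbar\operatorname{Tr}X$, so that the hypersurface $g_{\mathrm F}=0$ is $M_{\mathrm F}z\cdot z=\hbar$; the Fermi ellipsoid $\mathcal{W}_{\mathrm F}$ is the ellipsoid bounded by this hypersurface. A symplectic capacity on $\mathbb{R}^{2n}$ assigns to every subset $\Omega\subset\mathbb{R}^{2n}$ a number $c(\Omega)\in[0,+\infty]$ such that: (SC1) $\Omega\subset\Omega'$ implies $c(\Omega)\le c(\Omega')$; (SC2) $c(f(\Omega))=c(\Omega)$ for every canonical transformation (symplectomorphism) $f$ of $\mathbb{R}^{2n}$; (SC3)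 $c(\lambda\Omega)=\lambda^2c(\Omega)$ for every real $\lambda$; (SC4) $c(B^{2n}(R))=\pi R^2=c(Z_j^{2n}(R))$ for all $R>0$ and $1\le j\le n$, where $B^{2n}(R)=\{|x|^2+|p|^2\le R^2\}$ and $Z_j^{2n}(R)=\{x_j^2+p_j^2\le R^2\}$. *)

theory Defs
  imports "HOL-Analysis.Analysis"
begin

text \<open>
  Phase space is \<open>real^('n+'n)\<close>: the coordinates \<open>Inl j\<close> carry the position \<open>x\<close>,
  the coordinates \<open>Inr j\<close> the momentum \<open>p\<close>, and \<open>n = CARD('n)\<close>.
\<close>

type_synonym 'n phase_space = "real^('n + 'n)"

definition position :: "'n::finite phase_space \<Rightarrow> real^'n" where
  "position z = (\<chi> j. z $ Inl j)"

definition momentum :: "'n::finite phase_space \<Rightarrow> real^'n" where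
  "momentum z = (\<chi> j. z $ Inr j)"

definition block_matrix ::
  "real^'n^'n \<Rightarrow> real^'n^'n \<Rightarrow> real^'n^'n \<Rightarrow> real^'n^'n \<Rightarrow> real^('n::finite + 'n)^('n + 'n)" where
  "block_matrix A B C D = (\<chi> r s. case (r, s) of
      (Inl i, Inl j) \<Rightarrow> A $ i $ j
    | (Inl i, Inr j) \<Rightarrow> B $ i $ j
    | (Inr i, Inl j) \<Rightarrow> C $ i $ j
    | (Inr i, Inr j) \<Rightarrow> D $ i $ j)"

definition J_mat :: "real^('n::finite + 'n)^('n + 'n)" where
  "J_mat = block_matrix (mat 0) (mat 1) (- mat 1) (mat 0)"

definition symplectic_group :: "(real^('n::finite + 'n)^('n + 'n)) set" where
  "symplectic_group = {S. transpose S ** J_mat ** S = J_mat}"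

definition represented_in_symplectic_coordinates ::
  "'n::finite phase_space set \<Rightarrow> (real^'n \<Rightarrow> real^'n \<Rightarrow> bool) \<Rightarrow> bool" where
  "represented_in_symplectic_coordinates W ineq \<longleftrightarrow>
     (\<exists>S\<in>symplectic_group. (\<lambda>z. S *v z) ` W = {z. ineq (position z) (momentum z)})"


definition symmetric_matrix :: "real^'n^'n \<Rightarrow> bool" where
  "symmetric_matrix A \<longleftrightarrow> transpose A = A"

definition positive_definite :: "real^'n^'n \<Rightarrow> bool" where
  "positive_definite A \<longleftrightarrow> (\<forall>v. v \<noteq> 0 \<longrightarrow> 0 < (A *v v) \<bullet> v)"

definition eigenvalue :: "real^'n^'n \<Rightarrow> real \<Rightarrow> bool" where
  "eigenvalue A e \<longleftrightarrow> (\<exists>v. v \<noteq> 0 \<and> A *v v = e *\<^sub>R v)"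

text \<open>
  \<open>lam\<close> lists the eigenvalues of \<open>A\<close> repeated according to multiplicity: the
  characteristic polynomial of \<open>A\<close> splits as the product of the \<open>t - lam j\<close>.
\<close>

definition lists_eigenvalues :: "real^'n^'n \<Rightarrow> ('n::finite \<Rightarrow> real) \<Rightarrow> bool" where
  "lists_eigenvalues A lam \<longleftrightarrow> (\<forall>t. det (mat t - A) = (\<Prod>j\<in>UNIV. t - lam j))"

definition largest_eigenvalue :: "real^'n^'n \<Rightarrow> real" where
  "largest_eigenvalue A = Max {e. eigenvalue A e}"


text \<open>
  A map on a finite-dimensional space is \<open>C\<^sup>k\<^sup>+\<^sup>1\<close> iff it is differentiable and all its
  directional derivatives are \<open>C\<^sup>k\<close>.
\<close>

primrec C_k_map :: "nat \<Rightarrow> ('a::euclidean_space \<Rightarrow> 'b::euclidean_space) \<Rightarrow> bool" where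
  "C_k_map 0 f \<longleftrightarrow> continuous_on UNIV f"
| "C_k_map (Suc k) f \<longleftrightarrow> (\<forall>z. f differentiable (at z)) \<and>
     (\<forall>v. C_k_map k (\<lambda>z. frechet_derivative f (at z) v))"

definition smooth_map :: "('a::euclidean_space \<Rightarrow> 'b::euclidean_space) \<Rightarrow> bool" where
  "smooth_map f \<longleftrightarrow> (\<forall>k. C_k_map k f)"

definition symplectomorphism :: "('n::finite phase_space \<Rightarrow> 'n phase_space) \<Rightarrow> bool" where
  "symplectomorphism f \<longleftrightarrow> bij f \<and> smooth_map f \<and> smooth_map (inv f) \<and>
     (\<forall>z. matrix (frechet_derivative f (at z)) \<in> symplectic_group)"

definition phase_ball :: "real \<Rightarrow> 'n::finite phase_space set" where
  "phase_ball r = {z. (norm (position z))\<^sup>2 + (norm (momentum z))\<^sup>2 \<le> r\<^sup>2}"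

definition phase_cylinder :: "'n::finite \<Rightarrow> real \<Rightarrow> 'n phase_space set" where
  "phase_cylinder j r = {z. (position z $ j)\<^sup>2 + (momentum z $ j)\<^sup>2 \<le> r\<^sup>2}"

text \<open>
  In the scaling axiom with \<open>a = 0\<close> the convention \<open>0 * \<infinity> = 0\<close> of \<^typ>\<open>ennreal\<close> is the
  right one: the capacity of \<open>{0}\<close> is \<open>0\<close> by the first and the last axiom.
\<close>

definition symplectic_capacity :: "('n::finite phase_space set \<Rightarrow> ennreal) \<Rightarrow> bool" where
  "symplectic_capacity c \<longleftrightarrow>
     (\<forall>A B. A \<subseteq> B \<longrightarrow> c A \<le> c B) \<and>
     (\<forall>f A. symplectomorphism f \<longrightarrow> c (f ` A) = c A) \<and>
     (\<forall>(a::real) A. c ((\<lambda>z. a *\<^sub>R z) ` A) = ennreal (a\<^sup>2) * c A) \<and>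
     (\<forall>r>0. c (phase_ball r) = ennreal (pi * r\<^sup>2) \<and>
        (\<forall>j. c (phase_cylinder j r) = ennreal (pi * r\<^sup>2)))"


definition fermi_matrix :: "real^'n^'n \<Rightarrow> real^'n^'n \<Rightarrow> real^('n::finite + 'n)^('n + 'n)" where
  "fermi_matrix X Y =
     (1 / trace X) *\<^sub>R block_matrix (X ** X + Y ** Y) Y Y (mat 1)"

definition fermi_ellipsoid ::
  "real \<Rightarrow> real^'n^'n \<Rightarrow> real^'n^'n \<Rightarrow> 'n::finite phase_space set" where
  "fermi_ellipsoid hbar X Y = {z. (fermi_matrix X Y *v z) \<bullet> z \<le> hbar}"

text \<open>
  The remaining definitions and lemmas justify the name: \<open>fermi_ellipsoid hbar X Y\<close> is the
  set bounded by the zero locus of Fermi's function of the squeezed coherent state.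
\<close>

definition squeezed_coherent_state ::
  "real \<Rightarrow> real^'n^'n \<Rightarrow> real^'n^'n \<Rightarrow> real^'n::finite \<Rightarrow> complex" where
  "squeezed_coherent_state hbar X Y x =
     of_real ((pi * hbar) powr (- real CARD('n) / 4) * det X powr (1 / 4)) *
     exp (- (1 / (2 * of_real hbar)) *
       (of_real ((X *v x) \<bullet> x) + \<i> * of_real ((Y *v x) \<bullet> x)))"

definition gradient :: "(real^'n \<Rightarrow> real) \<Rightarrow> real^'n \<Rightarrow> real^'n::finite" where
  "gradient f x = (\<chi> j. frechet_derivative f (at x) (axis j 1))"

definition laplacian :: "(real^'n \<Rightarrow> real) \<Rightarrow> real^'n::finite \<Rightarrow> real" where
  "laplacian f x =
     (\<Sum>j\<in>UNIV. frechet_derivative (\<lambda>y. frechet_derivative f (at y) (axis j 1)) (at x) (axis j 1))"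

definition fermi_function ::
  "real \<Rightarrow> (real^'n \<Rightarrow> real) \<Rightarrow> (real^'n \<Rightarrow> real) \<Rightarrow> 'n::finite phase_space \<Rightarrow> real" where
  "fermi_function hbar R \<Phi> z =
     (norm (momentum z - gradient \<Phi> (position z)))\<^sup>2
     + hbar\<^sup>2 * (laplacian R (position z) / R (position z))"

definition squeezed_amplitude :: "real \<Rightarrow> real^'n^'n \<Rightarrow> real^'n::finite \<Rightarrow> real" where
  "squeezed_amplitude hbar X x =
     (pi * hbar) powr (- real CARD('n) / 4) * det X powr (1 / 4)
     * exp (- ((X *v x) \<bullet> x) / (2 * hbar))"

definition squeezed_phase :: "real^'n^'n \<Rightarrow> real^'n::finite \<Rightarrow> real" where
  "squeezed_phase Y x = - ((Y *v x) \<bullet> x) / 2"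

lemma squeezed_coherent_state_polar:
  "squeezed_coherent_state hbar X Y x =
     of_real (squeezed_amplitude hbar X x) * exp (\<i> * of_real (squeezed_phase Y x / hbar))"
proof -
  have "- (1 / (2 * complex_of_real hbar)) *
       (of_real ((X *v x) \<bullet> x) + \<i> * of_real ((Y *v x) \<bullet> x))
     = of_real (- ((X *v x) \<bullet> x) / (2 * hbar)) + \<i> * of_real (squeezed_phase Y x / hbar)"
    by (simp add: squeezed_phase_def algebra_simps add_divide_distrib)
  then show ?thesis
    by (simp only: squeezed_coherent_state_def squeezed_amplitude_def exp_add
        exp_of_real[symmetric] of_real_mult mult.assoc)
qed

lemma squeezed_amplitude_nonneg: "0 \<le> squeezed_amplitude hbar X x"
  by (simp add: squeezed_amplitude_def)

lemma symmetric_matrix_inner: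
  assumes "symmetric_matrix A"
  shows "(A *v u) \<bullet> v = (A *v v) \<bullet> u"
  using assms dot_lmul_matrix[of v A u]
  by (simp add: symmetric_matrix_def inner_commute
      transpose_matrix_vector[symmetric])

lemma has_derivative_quadratic:
  assumes "symmetric_matrix A"
  shows "((\<lambda>x. (A *v x) \<bullet> x) has_derivative (\<lambda>v. 2 * ((A *v x) \<bullet> v))) (at x)"
proof -
  have "((\<lambda>x. (A *v x) \<bullet> x) has_derivative (\<lambda>v. (A *v x) \<bullet> v + (A *v v) \<bullet> x)) (at x)"
    by (intro has_derivative_inner bounded_linear_imp_has_derivative
        matrix_vector_mul_bounded_linear has_derivative_ident)
  then show ?thesis
    by (simp add: symmetric_matrix_inner[OF assms, of _ x])
qed

lemma gradient_squeezed_phase: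
  assumes "symmetric_matrix Y"
  shows "gradient (squeezed_phase Y) x = - (Y *v x)"
proof -
  have "(squeezed_phase Y has_derivative (\<lambda>v. - ((Y *v x) \<bullet> v))) (at x)"
    unfolding squeezed_phase_def
    by (rule derivative_eq_intros has_derivative_quadratic[OF assms] refl | simp)+
  then have "frechet_derivative (squeezed_phase Y) (at x) = (\<lambda>v. - ((Y *v x) \<bullet> v))"
    by (metis frechet_derivative_at)
  then show ?thesis
    by (simp add: gradient_def vec_eq_iff inner_axis)
qed

lemma laplacian_squeezed_amplitude:
  assumes X: "symmetric_matrix X" and "hbar > 0"
  shows "laplacian (squeezed_amplitude hbar X) x =
    squeezed_amplitude hbar X x * ((norm (X *v x))\<^sup>2 / hbar\<^sup>2 - trace X / hbar)"
proof -
  let ?R = "squeezed_amplitude hbar X"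
  have D: "(?R has_derivative (\<lambda>v. - (?R y * ((X *v y) \<bullet> v) / hbar))) (at y)" for y
  proof -
    have "((\<lambda>x. - ((X *v x) \<bullet> x) / (2 * hbar)) has_derivative
        (\<lambda>v. - (2 * ((X *v y) \<bullet> v)) / (2 * hbar))) (at y)"
      by (intro bounded_linear.has_derivative[OF bounded_linear_divide] has_derivative_minus
          has_derivative_quadratic[OF X])
    from has_derivative_mult_right[OF has_derivative_exp[OF this]] show ?thesis
      unfolding squeezed_amplitude_def
      by (rule has_derivative_eq_rhs) (simp add: fun_eq_iff)
  qed
  then have F: "frechet_derivative ?R (at y) = (\<lambda>v. - (?R y * ((X *v y) \<bullet> v) / hbar))" for y
    by (metis frechet_derivative_at)
  have D2: "((\<lambda>y. - (?R y * ((X *v y) \<bullet> v) / hbar)) has_derivative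
    (\<lambda>w. - ((?R x * ((X *v w) \<bullet> v) + - (?R x * ((X *v x) \<bullet> w) / hbar) * ((X *v x) \<bullet> v)) / hbar)))
    (at x)" for v
  proof -
    have "((\<lambda>y. (X *v y) \<bullet> v) has_derivative (\<lambda>w. (X *v w) \<bullet> v)) (at x)"
      by (intro has_derivative_inner_left bounded_linear_imp_has_derivative
          matrix_vector_mul_bounded_linear)
    from has_derivative_mult[OF D this] show ?thesis
      by (intro has_derivative_minus bounded_linear.has_derivative[OF bounded_linear_divide])
  qed
  have "laplacian ?R x = (\<Sum>j\<in>UNIV.
      ?R x * (((X *v x) $ j)\<^sup>2 / hbar\<^sup>2 - X $ j $ j / hbar))"
    unfolding laplacian_def F
    by (intro sum.cong refl, subst frechet_derivative_at[OF D2, symmetric])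
      (simp add: inner_axis matrix_vector_mult_basis column_def power2_eq_square
          algebra_simps diff_divide_distrib)
  also have "\<dots> = ?R x * ((norm (X *v x))\<^sup>2 / hbar\<^sup>2 - trace X / hbar)"
    unfolding sum_distrib_left[symmetric] sum_subtractf sum_divide_distrib[symmetric]
      trace_def power2_norm_eq_inner inner_vec_def
    by (simp add: power2_eq_square)
  finally show ?thesis .
qed

lemma det_positive_definite:
  fixes X :: "real^'n::finite^'n"
  assumes "positive_definite X"
  shows "det X > 0"
proof (rule ccontr)
  assume neg: "\<not> det X > 0"
  define f where "f = (\<lambda>t::real. det ((1 - t) *\<^sub>R mat 1 + t *\<^sub>R X))"
  have "continuous_on {0..1} f"
    unfolding f_def det_def by (intro continuous_intros)
  moreover have "f 0 = 1" "f 1 = det X"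
    by (simp_all add: f_def)
  ultimately obtain t where t: "0 \<le> t" "t \<le> 1" "f t = 0"
    using IVT2'[of f 1 0 0] neg by auto
  then obtain v where v: "v \<noteq> 0" "((1 - t) *\<^sub>R mat 1 + t *\<^sub>R X) *v v = 0"
    unfolding f_def by (metis invertible_det_nz matrix_left_invertible_ker
        invertible_left_inverse)
  have "(1 - t) * (v \<bullet> v) + t * ((X *v v) \<bullet> v)
      = (((1 - t) *\<^sub>R mat 1 + t *\<^sub>R X) *v v) \<bullet> v"
    by (simp add: matrix_vector_mult_add_rdistrib scaleR_matrix_vector_assoc[symmetric]
        inner_add_left)
  with v(2) have "(1 - t) * (v \<bullet> v) + t * ((X *v v) \<bullet> v) = 0"
    by simp
  moreover have "v \<bullet> v > 0" "(X *v v) \<bullet> v > 0"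
    using v(1) assms by (auto simp: positive_definite_def)
  ultimately show False
    using t(1,2) add_nonneg_pos[of "(1 - t) * (v \<bullet> v)" "t * ((X *v v) \<bullet> v)"]
    by (cases "t = 0") auto
qed

lemma trace_positive_definite:
  fixes X :: "real^'n::finite^'n"
  assumes "positive_definite X"
  shows "trace X > 0"
  unfolding trace_def
proof (rule sum_pos)
  fix i :: 'n
  have "(X *v axis i 1) \<bullet> axis i 1 > 0"
    using assms by (simp add: positive_definite_def axis_eq_0_iff)
  then show "X $ i $ i > 0"
    by (simp add: inner_axis matrix_vector_mult_basis column_def)
qed auto

lemma fermi_function_squeezed:
  assumes "symmetric_matrix X" "positive_definite X" "symmetric_matrix Y" "hbar > 0"
  shows "fermi_function hbar (squeezed_amplitude hbar X) (squeezed_phase Y) z =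
    (norm (momentum z + Y *v position z))\<^sup>2
    + ((X ** X) *v position z) \<bullet> position z - hbar * trace X"
proof -
  have "squeezed_amplitude hbar X (position z) > 0"
    using det_positive_definite[OF assms(2)] assms(4) by (simp add: squeezed_amplitude_def)
  moreover have "((X ** X) *v position z) \<bullet> position z = (norm (X *v position z))\<^sup>2"
    by (simp add: matrix_vector_mul_assoc[symmetric] power2_norm_eq_inner
        symmetric_matrix_inner[OF assms(1), of "X *v position z"])
  ultimately show ?thesis
    using assms
    by (simp add: fermi_function_def gradient_squeezed_phase laplacian_squeezed_amplitude)
      (simp add: field_simps power2_eq_square)
qed

lemma block_matrix_quadratic_form:
  "(block_matrix A B C D *v z) \<bullet> z =
     (A *v position z + B *v momentum z) \<bullet> position z
     + (C *v position z + D *v momentum z) \<bullet> momentum z"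
  by (simp add: inner_vec_def matrix_vector_mult_def block_matrix_def position_def
      momentum_def UNIV_Plus_UNIV[symmetric] sum.Plus del: UNIV_Plus_UNIV)

lemma fermi_ellipsoid_eq_fermi_function:
  assumes "symmetric_matrix X" "positive_definite X" "symmetric_matrix Y" "hbar > 0"
  shows "fermi_ellipsoid hbar X Y =
     {z. fermi_function hbar (squeezed_amplitude hbar X) (squeezed_phase Y) z \<le> 0}"
proof -
  have "(fermi_matrix X Y *v z) \<bullet> z \<le> hbar \<longleftrightarrow>
      (norm (momentum z + Y *v position z))\<^sup>2
      + ((X ** X) *v position z) \<bullet> position z - hbar * trace X \<le> 0" for z
  proof -
    let ?x = "position z" and ?p = "momentum z"
    have Y2: "((Y ** Y) *v ?x) \<bullet> ?x = (Y *v ?x) \<bullet> (Y *v ?x)"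
      by (simp add: matrix_vector_mul_assoc[symmetric]
          symmetric_matrix_inner[OF assms(3), of "Y *v ?x"])
    have "(fermi_matrix X Y *v z) \<bullet> z = (1 / trace X) *
        ((norm (?p + Y *v ?x))\<^sup>2 + ((X ** X) *v ?x) \<bullet> ?x)"
      unfolding fermi_matrix_def scaleR_matrix_vector_assoc[symmetric] inner_scaleR_left
        block_matrix_quadratic_form power2_norm_eq_inner
      using symmetric_matrix_inner[OF assms(3), of ?p ?x] Y2
      by (simp add: matrix_vector_mult_add_rdistrib inner_add_left inner_add_right
          inner_commute)
    then show ?thesis
      using trace_positive_definite[OF assms(2)] by (simp add: pos_divide_le_eq add.commute)
  qed
  then show ?thesis
    by (simp add: fermi_ellipsoid_def fermi_function_squeezed[OF assms])
qed

end

theory Submission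
  imports Defs
begin

text \<open>
  If \<open>A B = I\<close> and \<open>Y\<close> is symmetric, then \<open>(x, p) \<mapsto> (A x, B\<^sup>T (Y x + p))\<close> is symplectic. Since
  \<open>Tr X (M\<^sub>F z \<bullet> z) = |X x|\<^sup>2 + |p + Y x|\<^sup>2\<close>, it carries the Fermi ellipsoid to
  \<open>P x \<bullet> x + P p \<bullet> p \<le> hbar Tr X\<close> as soon as \<open>A\<^sup>T P A = X\<^sup>2\<close> and \<open>B P B\<^sup>T = I\<close>. With
  \<open>X = U D U\<^sup>T\<close>, the choices \<open>A = X\<^sup>1\<^sup>/\<^sup>2\<close>, \<open>P = X\<close> and \<open>A = D\<^sup>1\<^sup>/\<^sup>2 U\<^sup>T\<close>, \<open>P = D\<close> give the two
  normal forms. The second one lies between the ball and the cylinder of squared radius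
  \<open>hbar Tr X / \<lambda>\<^sub>m\<^sub>a\<^sub>x\<close>, which forces the value of every capacity.
\<close>

section \<open>The spectral theorem for real symmetric matrices\<close>

definition diagonal_matrix :: "('n \<Rightarrow> real) \<Rightarrow> real^'n^'n" where
  "diagonal_matrix d = (\<chi> i j. if i = j then d i else 0)"

lemma diagonal_matrix_mult_vec: "diagonal_matrix d *v v = (\<chi> i. d i * v $ i)"
  by (simp add: diagonal_matrix_def matrix_vector_mult_def vec_eq_iff if_distrib if_distribR
      cong: if_cong)

lemma diagonal_matrix_mult:
  "diagonal_matrix c ** diagonal_matrix d = diagonal_matrix (\<lambda>i. c i * d i)"
  by (simp add: matrix_eq matrix_vector_mul_assoc[symmetric] diagonal_matrix_mult_vec mult.assoc)

lemma transpose_diagonal_matrix: "transpose (diagonal_matrix d) = diagonal_matrix d"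
  by (auto simp: diagonal_matrix_def transpose_def vec_eq_iff)

lemma diagonal_matrix_one: "diagonal_matrix (\<lambda>_. 1) = mat 1"
  by (auto simp: diagonal_matrix_def mat_def vec_eq_iff)

text \<open>The sum over \<open>k\<close> turns a simultaneous permutation of columns and weights
  into a mere reindexing.\<close>

lemma diagonal_conj_component:
  fixes U :: "real^'n::finite^'n"
  shows "(U ** diagonal_matrix d ** transpose U) $ i $ j = (\<Sum>k\<in>UNIV. U $ i $ k * d k * U $ j $ k)"
  by (simp add: matrix_matrix_mult_def diagonal_matrix_def transpose_def if_distrib if_distribR
      cong: if_cong)

lemma orthogonal_conj_mult:
  fixes U :: "real^'n::finite^'n"
  assumes "orthogonal_matrix U"
  shows "(U ** C ** transpose U) ** (U ** D ** transpose U) = U ** (C ** D) ** transpose U"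
proof -
  have "(U ** C ** transpose U) ** (U ** D ** transpose U)
      = U ** C ** (transpose U ** U) ** D ** transpose U"
    by (simp add: matrix_mul_assoc)
  also have "transpose U ** U = mat 1"
    using assms by (simp add: orthogonal_matrix_def)
  finally show ?thesis
    by (simp add: matrix_mul_assoc)
qed

lemma mat_mult_vec: "mat t *v v = t *\<^sub>R v" for v :: "real^'n::finite"
  by (simp add: mat_def matrix_vector_mult_def vec_eq_iff if_distrib if_distribR cong: if_cong)

section \<open>Orthonormal eigenbases of symmetric matrices\<close>

text \<open>
  A maximiser \<open>v\<close> of the Rayleigh quotient, with maximum \<open>m\<close>, is an eigenvector: the form
  \<open>m |y|\<^sup>2 - A y \<bullet> y\<close> is nonnegative and vanishes at \<open>v\<close>, so its first variation at \<open>v\<close> in the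
  direction \<open>w = m v - A v\<close>, which is \<open>2 |w|\<^sup>2\<close>, is zero.
\<close>

lemma symmetric_eigenvector_exists:
  fixes A :: "real^'n::finite^'n"
  assumes A: "symmetric_matrix A" and S: "subspace S" "S \<noteq> {0}"
    and inv: "\<And>x. x \<in> S \<Longrightarrow> A *v x \<in> S"
  obtains v m where "v \<in> S" "norm v = 1" "A *v v = m *\<^sub>R v"
proof -
  let ?K = "S \<inter> sphere 0 1"
  obtain x where x: "x \<in> S" "x \<noteq> 0"
    using S subspace_0 by blast
  have "x /\<^sub>R norm x \<in> ?K"
    using x S(1) by (simp add: subspace_scale)
  then have "?K \<noteq> {}" by blast
  moreover have "compact ?K"
    using closed_subspace[OF S(1)] by (simp add: closed_Int_compact)
  moreover have "continuous_on ?K (\<lambda>x. (A *v x) \<bullet> x)"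
    by (intro continuous_intros linear_continuous_on matrix_vector_mul_bounded_linear)
  ultimately obtain v where v: "v \<in> ?K" and max: "\<And>y. y \<in> ?K \<Longrightarrow> (A *v y) \<bullet> y \<le> (A *v v) \<bullet> v"
    using continuous_attains_sup[of ?K "\<lambda>x. (A *v x) \<bullet> x"] by blast
  define m where "m = (A *v v) \<bullet> v"
  define w where "w = m *\<^sub>R v - A *v v"
  define q where "q = m * (w \<bullet> w) - (A *v w) \<bullet> w"
  \<comment> \<open>Homogeneity extends the bound from the unit vectors of \<open>S\<close> to all
    of \<open>S\<close>.\<close>
  have nonneg: "0 \<le> m * (y \<bullet> y) - (A *v y) \<bullet> y" if "y \<in> S" for y
  proof (cases "y = 0")
    case False
    have "y /\<^sub>R norm y \<in> ?K"
      using that False S(1) by (simp add: subspace_scale)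
    from max[OF this] have "((A *v y) \<bullet> y) / (norm y)\<^sup>2 \<le> m"
      by (simp add: m_def matrix_vector_mult_scaleR power2_eq_square divide_inverse mult_ac)
    then show ?thesis
      using False by (simp add: pos_divide_le_eq power2_norm_eq_inner)
  qed simp
  have wS: "w \<in> S"
    using v S(1) inv by (simp add: w_def subspace_diff subspace_scale)
  have vv: "v \<bullet> v = 1"
    using v by (simp add: norm_eq_1)
  have "w \<bullet> w = m * (v \<bullet> w) - (A *v v) \<bullet> w"
    unfolding w_def by (simp add: inner_diff_left inner_commute)
  then have vAw: "(A *v v) \<bullet> w = m * (v \<bullet> w) - w \<bullet> w" by simp
  \<comment> \<open>There is no constant term: \<open>v\<close> is a unit vector and
    \<open>m\<close> is the value of the form at \<open>v\<close>. The linear coefficient comes from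
    \<open>vAw\<close>.\<close>
  have expand: "m * ((v + t *\<^sub>R w) \<bullet> (v + t *\<^sub>R w)) - (A *v (v + t *\<^sub>R w)) \<bullet> (v + t *\<^sub>R w)
      = 2 * t * (w \<bullet> w) + t\<^sup>2 * q" for t
    using vv by (simp add: q_def symmetric_matrix_inner[OF A, of w v] vAw m_def[symmetric]
        matrix_vector_right_distrib matrix_vector_mult_scaleR inner_add_left inner_add_right
        inner_commute[of w v] power2_eq_square algebra_simps)
  have quad: "0 \<le> 2 * t * (w \<bullet> w) + t\<^sup>2 * q" for t
    using nonneg[of "v + t *\<^sub>R w"] v wS S(1)
    by (simp only: expand) (simp add: subspace_add subspace_scale)
  have q0: "0 \<le> q"
    using nonneg[OF wS] by (simp add: q_def)
  have "w \<bullet> w = 0"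
  proof (rule ccontr)
    assume nz: "w \<bullet> w \<noteq> 0"
    \<comment> \<open>At \<open>t = - s\<close> the quadratic equals
      \<open>- (s\<^sup>2 * (q + 2))\<close>, which is negative. The denominator
      \<open>q + 1\<close> stays positive even for \<open>q = 0\<close>.\<close>
    define s where "s = (w \<bullet> w) / (q + 1)"
    have s: "w \<bullet> w = s * (q + 1)" "s \<noteq> 0"
      using q0 nz by (simp_all add: s_def)
    have "2 * (- s) * (w \<bullet> w) + (- s)\<^sup>2 * q = - (s\<^sup>2 * (q + 2))"
      by (simp add: s(1) power2_eq_square algebra_simps)
    moreover have "0 < s\<^sup>2 * (q + 2)"
      using s(2) q0 by (intro mult_pos_pos) auto
    ultimately show False
      using quad[of "- s"] by linarith
  qed
  then have "A *v v = m *\<^sub>R v"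
    by (simp add: w_def)
  then show thesis
    using v by (intro that[of v m]) auto
qed

lemma symmetric_orthonormal_eigenvectors:
  fixes A :: "real^'n::finite^'n"
  assumes A: "symmetric_matrix A" and "subspace S"
    and "\<And>x. x \<in> S \<Longrightarrow> A *v x \<in> S"
  shows "\<exists>B. finite B \<and> B \<subseteq> S \<and> card B = dim S \<and> pairwise orthogonal B
           \<and> (\<forall>v\<in>B. norm v = 1 \<and> (\<exists>m. A *v v = m *\<^sub>R v))"
  using assms(2,3)
proof (induction "dim S" arbitrary: S)
  case 0
  then show ?case
    by (intro exI[of _ "{}"]) simp
next
  case (Suc k)
  then have "S \<noteq> {0}" by auto
  then obtain v m where v: "v \<in> S" "norm v = 1" "A *v v = m *\<^sub>R v"
    using symmetric_eigenvector_exists[OF A Suc.prems(1) _ Suc.prems(2)] by metis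
  \<comment> \<open>The complement of \<open>span {v}\<close> gives the dimension count; the
    hyperplane form in the fact \<open>T\<close> serves the remaining steps.\<close>
  define T where "T = {y \<in> S. \<forall>x \<in> span {v}. orthogonal x y}"
  have T: "T = S \<inter> {y. v \<bullet> y = 0}"
    by (auto simp: T_def orthogonal_def span_singleton)
  have "dim T + dim (span {v}) = dim S"
    unfolding T_def using v(1) Suc.prems(1)
    by (intro dim_subspace_orthogonal_to_vectors) (auto simp: span_minimal)
  moreover have "dim (span {v}) = 1"
    using v(2) by auto
  ultimately have dimT: "k = dim T"
    using Suc.hyps(2) by simp
  have subT: "subspace T"
    unfolding T using subspace_inter[OF Suc.prems(1) subspace_hyperplane] .
  \<comment> \<open>By symmetry, \<open>A *v x\<close> pairs with \<open>v\<close> as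
    \<open>x\<close> pairs with \<open>A *v v\<close>, a multiple of \<open>v\<close>.\<close>
  have "A *v x \<in> T" if "x \<in> T" for x
    using that Suc.prems(2) symmetric_matrix_inner[OF A, of x v] v(3)
    by (auto simp: T inner_commute)
  from Suc.hyps(1)[OF dimT subT this] obtain B where B:
    "finite B" "B \<subseteq> T" "card B = dim T" "pairwise orthogonal B"
    "\<forall>v\<in>B. norm v = 1 \<and> (\<exists>m. A *v v = m *\<^sub>R v)"
    by blast
  \<comment> \<open>All of \<open>B\<close> is orthogonal to the nonzero \<open>v\<close>, so
    inserting \<open>v\<close> raises the cardinality by one.\<close>
  have "v \<notin> B"
    using B(2) v(2) by (auto simp: T)
  then show ?case
    using B v dimT Suc.hyps(2)
    by (intro exI[of _ "insert v B"])
      (auto simp: pairwise_insert orthogonal_def T inner_commute)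
qed

lemma symmetric_matrix_diagonalization:
  fixes A :: "real^'n::finite^'n"
  assumes A: "symmetric_matrix A"
  obtains U d where "orthogonal_matrix U" "A = U ** diagonal_matrix d ** transpose U"
proof -
  obtain B :: "(real^'n) set" where B: "finite B" "card B = CARD('n)" "pairwise orthogonal B"
    and eig: "\<forall>v\<in>B. norm v = 1 \<and> (\<exists>m. A *v v = m *\<^sub>R v)"
    using symmetric_orthonormal_eigenvectors[OF A, of UNIV] by auto
  \<comment> \<open>The basis is indexed by \<open>'n\<close> so that its vectors can be the columns
    of \<open>U\<close>; injectivity of \<open>u\<close> makes distinct columns orthogonal.\<close>
  obtain u where u: "bij_betw u (UNIV :: 'n set) B"
    using B finite_same_card_bij[of "UNIV :: 'n set" B] by auto
  then have uB: "u j \<in> B" for j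
    by (auto simp: bij_betw_def)
  from uB eig have "\<exists>m. A *v u j = m *\<^sub>R u j" for j
    by blast
  then obtain d where d: "\<And>j. A *v u j = d j *\<^sub>R u j"
    by metis
  define U :: "real^'n^'n" where "U = (\<chi> i j. u j $ i)"
  have col: "column j U = u j" for j
    by (simp add: U_def column_def)
  have U: "orthogonal_matrix U"
    unfolding orthogonal_matrix_orthonormal_columns col
    using uB eig B(3) u by (auto simp: pairwise_def bij_betw_def inj_eq)
  have "A ** U = U ** diagonal_matrix d"
    using d by (simp add: vec_eq_iff matrix_matrix_mult_def matrix_vector_mult_def U_def
        diagonal_matrix_def if_distrib if_distribR mult.commute cong: if_cong)
  then have "A ** (U ** transpose U) = U ** diagonal_matrix d ** transpose U"
    by (simp add: matrix_mul_assoc)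
  then show thesis
    using U that by (simp add: orthogonal_matrix_def)
qed

section \<open>Eigenvalues with multiplicity and the characteristic polynomial\<close>

lemma poly_prod_determines_permutation:
  fixes a b :: "'n::finite \<Rightarrow> real"
  assumes "\<And>t. (\<Prod>j\<in>UNIV. t - a j) = (\<Prod>j\<in>UNIV. t - b j)"
  obtains p where "p permutes UNIV" "\<And>j. a j = b (p j)"
proof -
  have proots: "proots (\<Prod>j\<in>UNIV. [:- c j, 1:]) = image_mset c (mset_set UNIV)"
    for c :: "'n \<Rightarrow> real"
  proof -
    have "(\<Sum>j\<in>A. {#c j#}) = image_mset c (mset_set A)" if "finite A" for A :: "'n set"
      using that by induction auto
    then show ?thesis
      by (subst proots_prod) simp_all
  qed
  \<comment> \<open>Polynomials that agree at every real point are equal, so their multisets of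
    roots agree; a permutation then matches the two families.\<close>
  have "poly (\<Prod>j\<in>UNIV. [:- a j, 1:]) = poly (\<Prod>j\<in>UNIV. [:- b j, 1:])"
    using assms by (simp add: fun_eq_iff poly_prod)
  then have "image_mset a (mset_set UNIV) = image_mset b (mset_set UNIV)"
    by (simp only: poly_eq_poly_eq_iff flip: proots)
  then show thesis
    using image_mset_eq_implies_permutes[of UNIV a b] that by auto
qed

text \<open>Subtracting from \<open>mat t\<close> commutes with conjugation by \<open>U\<close>, and
  the conjugation leaves the determinant unchanged.\<close>

lemma lists_eigenvalues_conj_diagonal:
  fixes U :: "real^'n::finite^'n"
  assumes U: "orthogonal_matrix U"
  shows "lists_eigenvalues (U ** diagonal_matrix d ** transpose U) d"
proof -
  have "det (mat t - U ** diagonal_matrix d ** transpose U) = (\<Prod>j\<in>UNIV. t - d j)" for t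
  proof -
    have "mat t - U ** diagonal_matrix d ** transpose U
        = U ** diagonal_matrix (\<lambda>j. t - d j) ** transpose U"
    proof -
      have "diagonal_matrix (\<lambda>j. t - d j) *v y = t *\<^sub>R y - diagonal_matrix d *v y" for y
        by (simp add: diagonal_matrix_mult_vec vec_eq_iff left_diff_distrib)
      moreover have "U *v (transpose U *v x) = x" for x
        using U by (simp add: matrix_vector_mul_assoc orthogonal_matrix_def
            del: transpose_matrix_vector)
      ultimately show ?thesis
        by (simp add: matrix_eq mat_mult_vec matrix_vector_mult_diff_rdistrib
            matrix_vector_mult_diff_distrib matrix_vector_mult_scaleR
            flip: matrix_vector_mul_assoc)
    qed
    then have "det (mat t - U ** diagonal_matrix d ** transpose U)
        = det (diagonal_matrix (\<lambda>j. t - d j)) * det (U ** transpose U)"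
      by (simp add: det_mul)
    also have "\<dots> = (\<Prod>j\<in>UNIV. t - d j)"
      using U by (subst det_diagonal) (simp_all add: orthogonal_matrix_def diagonal_matrix_def)
    finally show ?thesis .
  qed
  then show ?thesis
    by (simp add: lists_eigenvalues_def)
qed

text \<open>Any listing is a permutation of the diagonal obtained from the spectral theorem;
  permuting the columns of the orthogonal matrix in the same way realises it. Thus the second normal
  form holds for every listing.\<close>

lemma lists_eigenvalues_diagonalization:
  fixes A :: "real^'n::finite^'n"
  assumes A: "symmetric_matrix A" and lam: "lists_eigenvalues A lam"
  obtains U where "orthogonal_matrix U" "A = U ** diagonal_matrix lam ** transpose U"
proof -
  obtain U d where U: "orthogonal_matrix U" and eq: "A = U ** diagonal_matrix d ** transpose U"
    using symmetric_matrix_diagonalization[OF A] .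
  have "(\<Prod>j\<in>UNIV. t - lam j) = (\<Prod>j\<in>UNIV. t - d j)" for t
    using lam lists_eigenvalues_conj_diagonal[OF U, of d] by (simp add: lists_eigenvalues_def eq)
  then obtain p where p: "p permutes UNIV" "\<And>j. lam j = d (p j)"
    using poly_prod_determines_permutation by blast
  have bij: "bij p"
    using p(1) by (rule permutes_bij)
  define V :: "real^'n^'n" where "V = (\<chi> i j. U $ i $ p j)"
  have "orthogonal_matrix V"
    using U bij_is_inj[OF bij]
    unfolding orthogonal_matrix_orthonormal_columns
    by (simp add: V_def column_def inj_eq)
  moreover have "U ** diagonal_matrix d ** transpose U = V ** diagonal_matrix lam ** transpose V"
    using sum.reindex_bij_betw[OF bij, of "\<lambda>k. U $ i $ k * d k * U $ j $ k" for i j]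
    by (simp add: vec_eq_iff diagonal_conj_component V_def p(2))
  ultimately show thesis
    using that eq by simp
qed

text \<open>\<open>mat e - A\<close> has a nontrivial kernel exactly when its determinant vanishes,
  that is, when a factor of the product does. This turns \<open>largest_eigenvalue\<close> into a
  maximum over the listed values.\<close>

lemma lists_eigenvalues_range:
  assumes "lists_eigenvalues A lam"
  shows "{e. eigenvalue A e} = range lam"
proof -
  have "eigenvalue A e \<longleftrightarrow> det (mat e - A) = 0" for e
  proof -
    have "det (mat e - A) = 0 \<longleftrightarrow> (\<exists>v. v \<noteq> 0 \<and> (mat e - A) *v v = 0)"
      by (metis invertible_det_nz invertible_left_inverse matrix_left_invertible_ker)
    then show ?thesis
      by (auto simp: eigenvalue_def matrix_vector_mult_diff_rdistrib mat_mult_vec)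
  qed
  then show ?thesis
    using assms by (auto simp: lists_eigenvalues_def)
qed

lemma lists_eigenvalues_pos:
  assumes "positive_definite A" "lists_eigenvalues A lam"
  shows "0 < lam j"
proof -
  have "eigenvalue A (lam j)"
    using lists_eigenvalues_range[OF assms(2)] by blast
  then obtain v where v: "v \<noteq> 0" "A *v v = lam j *\<^sub>R v"
    by (auto simp: eigenvalue_def)
  then have "0 < lam j * (v \<bullet> v)"
    using assms(1) by (metis positive_definite_def inner_scaleR_left)
  then show ?thesis
    using v(1) by (metis inner_gt_zero_iff zero_less_mult_pos2)
qed

lemma trace_conj_diagonal:
  fixes U :: "real^'n::finite^'n"
  assumes "orthogonal_matrix U"
  shows "trace (U ** diagonal_matrix d ** transpose U) = (\<Sum>j\<in>UNIV. d j)"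
proof -
  have "trace (U ** diagonal_matrix d ** transpose U) = trace (diagonal_matrix d ** transpose U ** U)"
    by (metis matrix_mul_assoc trace_mul_sym)
  then show ?thesis
    using assms by (simp add: orthogonal_matrix_def trace_def diagonal_matrix_def
        flip: matrix_mul_assoc)
qed

section \<open>Linear symplectic maps\<close>

lemma transpose_block_matrix:
  "transpose (block_matrix A B C D) =
     block_matrix (transpose A) (transpose C) (transpose B) (transpose D)"
  by (simp add: transpose_def block_matrix_def vec_eq_iff split: sum.splits)

lemma block_matrix_mult:
  "block_matrix A B C D ** block_matrix A' B' C' D' =
     block_matrix (A ** A' + B ** C') (A ** B' + B ** D') (C ** A' + D ** C') (C ** B' + D ** D')"
  by (auto simp: block_matrix_def matrix_matrix_mult_def vec_eq_iff UNIV_Plus_UNIV[symmetric]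
      sum.Plus simp del: UNIV_Plus_UNIV split: sum.splits)

lemma position_block_matrix:
  "position (block_matrix A B C D *v z) = A *v position z + B *v momentum z"
  by (simp add: matrix_vector_mult_def block_matrix_def position_def vec_eq_iff
      momentum_def UNIV_Plus_UNIV[symmetric] sum.Plus del: UNIV_Plus_UNIV)

lemma momentum_block_matrix:
  "momentum (block_matrix A B C D *v z) = C *v position z + D *v momentum z"
  by (simp add: matrix_vector_mult_def block_matrix_def position_def vec_eq_iff
      momentum_def UNIV_Plus_UNIV[symmetric] sum.Plus del: UNIV_Plus_UNIV)

lemma matrix_minus_mult: "(- A) ** B = - (A ** B)" for A :: "'a::ring_1^'n^'m"
  by (simp add: matrix_matrix_mult_def vec_eq_iff sum_negf)

lemma matrix_mult_minus: "A ** (- B) = - (A ** B)" for A :: "'a::ring_1^'n^'m"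
  by (simp add: matrix_matrix_mult_def vec_eq_iff sum_negf)

lemma J_mat_square: "J_mat ** J_mat = - mat 1"
  by (simp add: J_mat_def block_matrix_mult matrix_minus_mult)
    (simp add: block_matrix_def vec_eq_iff mat_def split: sum.splits)

text \<open>Multiplying the defining relation by \<open>- J_mat\<close> from the left exhibits
  \<open>- (J_mat ** transpose S ** J_mat)\<close> as a left inverse.\<close>

lemma symplectic_invertible:
  assumes "S \<in> symplectic_group"
  shows "invertible S"
proof -
  have "- (J_mat ** transpose S ** J_mat) ** S = - (J_mat ** (transpose S ** J_mat ** S))"
    by (simp add: matrix_minus_mult matrix_mul_assoc)
  also have "\<dots> = mat 1"
    using assms by (simp add: symplectic_group_def J_mat_square)
  finally show ?thesis
    by (auto simp: invertible_left_inverse)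
qed

text \<open>The matrix is the shear \<open>(x, p) \<mapsto> (x, Y x + p)\<close>, symplectic because
  \<open>Y\<close> is symmetric, followed by \<open>A\<close> on positions and its inverse transpose
  on momenta.\<close>

lemma block_symplectic:
  fixes A B Y :: "real^'n::finite^'n"
  assumes AB: "A ** B = mat 1" and Y: "symmetric_matrix Y"
  shows "block_matrix A (mat 0) (transpose B ** Y) (transpose B) \<in> symplectic_group"
proof -
  have BA: "B ** A = mat 1"
    using AB by (simp add: matrix_left_right_inverse)
  have transposes: "transpose A ** transpose B = mat 1"
    using BA by (metis matrix_transpose_mul transpose_mat)
  have zero: "transpose (0 :: real^'n^'n) = 0"
    by (simp add: transpose_def vec_eq_iff)
  have "Y ** B ** A = Y" "transpose A ** (transpose B ** Y) = Y"
    using BA transposes by (simp_all add: matrix_mul_assoc) (simp flip: matrix_mul_assoc)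
  then show ?thesis
    using Y BA transposes
    by (simp add: symplectic_group_def J_mat_def transpose_block_matrix block_matrix_mult
        matrix_minus_mult matrix_transpose_mul symmetric_matrix_def zero matrix_mult_minus)
qed

lemma bij_symplectic:
  assumes "S \<in> symplectic_group"
  shows "bij (\<lambda>z. S *v z)"
proof -
  obtain T where "S ** T = mat 1" "T ** S = mat 1"
    using symplectic_invertible[OF assms] by (auto simp: invertible_def)
  then show ?thesis
    by (intro o_bij[of "\<lambda>z. T *v z"]) (simp_all add: fun_eq_iff matrix_vector_mul_assoc)
qed

section \<open>Linear symplectic maps as symplectomorphisms\<close>

lemma C_k_map_const: "C_k_map k (\<lambda>z::'a::euclidean_space. c::'b::euclidean_space)"
  by (induction k arbitrary: c) auto

text \<open>A linear map is its own derivative at every point, so each directional derivative is a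
  constant map.\<close>

lemma smooth_map_linear:
  fixes f :: "'a::euclidean_space \<Rightarrow> 'b::euclidean_space"
  assumes "linear f"
  shows "smooth_map f"
proof -
  have D: "(f has_derivative f) (at z)" for z
    using assms by (simp add: linear_imp_has_derivative)
  have "C_k_map k f" for k
  proof (cases k)
    case 0
    then show ?thesis
      using assms by (simp add: linear_continuous_on linear_conv_bounded_linear)
  next
    case (Suc m)
    then show ?thesis
      using D frechet_derivative_at[OF D]
      by (auto simp: differentiable_def C_k_map_const simp flip: frechet_derivative_at[OF D])
  qed
  then show ?thesis
    by (simp add: smooth_map_def)
qed

lemma symplectomorphism_linear:
  assumes S: "S \<in> symplectic_group"
  shows "symplectomorphism (\<lambda>z. S *v z)"
proof -
  have lin: "linear (\<lambda>z. S *v z)"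
    by simp
  have bij: "bij (\<lambda>z. S *v z)"
    using S by (rule bij_symplectic)
  have "linear (inv (\<lambda>z. S *v z))"
    using lin bij inj_linear_imp_inv_linear by (auto simp: bij_def)
  moreover have "frechet_derivative (\<lambda>z. S *v z) (at z) = (\<lambda>z. S *v z)" for z
    by (metis frechet_derivative_at linear_imp_has_derivative lin)
  ultimately show ?thesis
    using S lin bij by (simp add: symplectomorphism_def smooth_map_linear)
qed

lemma capacity_symplectic_coordinates:
  assumes "symplectic_capacity c" "represented_in_symplectic_coordinates W P"
  shows "c W = c {z. P (position z) (momentum z)}"
  using assms symplectomorphism_linear
  unfolding symplectic_capacity_def represented_in_symplectic_coordinates_def by metis

section \<open>The Fermi ellipsoid\<close>

text \<open>Completing the square leaves \<open>X\<^sup>2 x \<bullet> x\<close> plus the squared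
  norm of \<open>Y x + p\<close>. The hypotheses on \<open>P\<close> make its form pull back to the
  first term under \<open>A\<close> and to the second under \<open>transpose B\<close>. Keeping
  \<open>P\<close> general covers both normal forms.\<close>

lemma fermi_ellipsoid_represented:
  fixes X Y A B P :: "real^'n::finite^'n"
  assumes Y: "symmetric_matrix Y" and tr: "0 < trace X" and AB: "A ** B = mat 1"
    and PA: "transpose A ** P ** A = X ** X" and PB: "B ** P ** transpose B = mat 1"
  shows "represented_in_symplectic_coordinates (fermi_ellipsoid hbar X Y)
    (\<lambda>x p. (P *v x) \<bullet> x + (P *v p) \<bullet> p \<le> hbar * trace X)"
proof -
  define S where "S = block_matrix A (mat 0) (transpose B ** Y) (transpose B)"
  have S: "S \<in> symplectic_group"
    unfolding S_def using AB Y by (rule block_symplectic)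
  have pull: "(P *v (C *v x)) \<bullet> (C *v x) = ((transpose C ** P ** C) *v x) \<bullet> x"
    for C :: "real^'n^'n" and x
    by (metis dot_lmul_matrix inner_commute matrix_vector_mul_assoc transpose_matrix_vector)
  have iff: "z \<in> fermi_ellipsoid hbar X Y \<longleftrightarrow>
      (P *v position (S *v z)) \<bullet> position (S *v z) + (P *v momentum (S *v z)) \<bullet> momentum (S *v z)
      \<le> hbar * trace X" for z
  proof -
    let ?x = "position z" and ?p = "momentum z"
    have pos: "position (S *v z) = A *v ?x"
      by (simp add: S_def position_block_matrix)
    have mom: "momentum (S *v z) = transpose B *v (Y *v ?x + ?p)"
      by (simp add: S_def momentum_block_matrix matrix_vector_right_distrib matrix_vector_mul_assoc)
    have Y2: "((Y ** Y) *v ?x) \<bullet> ?x = (Y *v ?x) \<bullet> (Y *v ?x)"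
      by (simp add: matrix_vector_mul_assoc[symmetric] symmetric_matrix_inner[OF Y, of "Y *v ?x"])
    have "(fermi_matrix X Y *v z) \<bullet> z = (1 / trace X) *
        (((X ** X) *v ?x) \<bullet> ?x + (Y *v ?x + ?p) \<bullet> (Y *v ?x + ?p))"
      unfolding fermi_matrix_def scaleR_matrix_vector_assoc[symmetric] inner_scaleR_left
        block_matrix_quadratic_form
      using symmetric_matrix_inner[OF Y, of ?p ?x] Y2
      by (simp add: matrix_vector_mult_add_rdistrib inner_add_left inner_add_right inner_commute)
    then show ?thesis
      using tr by (simp add: fermi_ellipsoid_def pos mom pull PA PB pos_divide_le_eq
          del: transpose_matrix_vector)
  qed
  \<comment> \<open>\<open>iff\<close> describes only preimages under \<open>S\<close>; surjectivity
    turns this into the equality for the image.\<close>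
  have "surj (\<lambda>z. S *v z)"
    using bij_symplectic[OF S] by (simp add: bij_def)
  then have "(\<lambda>z. S *v z) ` fermi_ellipsoid hbar X Y =
      {z. (P *v position z) \<bullet> position z + (P *v momentum z) \<bullet> momentum z \<le> hbar * trace X}"
    using iff by (auto simp: surj_def image_iff) metis
  then show ?thesis
    unfolding represented_in_symplectic_coordinates_def using S by blast
qed

text \<open>The ellipsoid contains a ball and lies in a cylinder of the same radius, and every
  capacity takes the same value on these two.\<close>

lemma capacity_weighted_ellipsoid:
  assumes c: "symplectic_capacity c" and lam: "\<And>j. 0 < lam j" and "0 < E"
  shows "c {z::'n::finite phase_space.
      (\<Sum>j\<in>UNIV. lam j * ((position z $ j)\<^sup>2 + (momentum z $ j)\<^sup>2)) \<le> E}
    = ennreal (pi * (E / Max (range lam)))" (is "c ?W = _")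
proof -
  define M where "M = Max (range lam)"
  have le: "lam j \<le> M" for j
    by (simp add: M_def)
  have "M \<in> range lam"
    unfolding M_def by (rule Max_in) auto
  then obtain k where k: "M = lam k"
    by auto
  have M: "0 < M"
    using lam k by simp
  \<comment> \<open>The squared radius is that of the disc cut out in the plane of the largest
    weight.\<close>
  define r where "r = sqrt (E / M)"
  have r: "0 < r" "r\<^sup>2 = E / M"
    using \<open>0 < E\<close> M by (simp_all add: r_def)
  have "z \<in> ?W" if "z \<in> phase_ball r" for z
  proof -
    have "(\<Sum>j\<in>UNIV. lam j * ((position z $ j)\<^sup>2 + (momentum z $ j)\<^sup>2))
        \<le> (\<Sum>j\<in>UNIV. M * ((position z $ j)\<^sup>2 + (momentum z $ j)\<^sup>2))"
      by (intro sum_mono mult_right_mono le) simp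
    also have "\<dots> = M * ((norm (position z))\<^sup>2 + (norm (momentum z))\<^sup>2)"
      unfolding power2_norm_eq_inner inner_vec_def
      by (simp add: power2_eq_square sum.distrib flip: sum_distrib_left)
    also have "\<dots> \<le> E"
      using that M by (simp add: phase_ball_def r(2) pos_le_divide_eq mult.commute)
    finally show ?thesis by simp
  qed
  then have "c (phase_ball r) \<le> c ?W"
    using c unfolding symplectic_capacity_def by blast
  \<comment> \<open>All terms are nonnegative, so the single term at the maximising index
    \<open>k\<close> is already at most \<open>E\<close>.\<close>
  moreover have "z \<in> phase_cylinder k r" if "z \<in> ?W" for z
  proof -
    have "lam k * ((position z $ k)\<^sup>2 + (momentum z $ k)\<^sup>2)
        \<le> (\<Sum>j\<in>UNIV. lam j * ((position z $ j)\<^sup>2 + (momentum z $ j)\<^sup>2))"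
      by (rule member_le_sum) (auto intro!: mult_nonneg_nonneg less_imp_le[OF lam])
    also have "\<dots> \<le> E"
      using that by simp
    finally show ?thesis
      using M by (simp add: phase_cylinder_def r(2) k pos_le_divide_eq mult.commute)
  qed
  then have "c ?W \<le> c (phase_cylinder k r)"
    using c unfolding symplectic_capacity_def by blast
  moreover have "c (phase_ball r) = ennreal (pi * r\<^sup>2)" "c (phase_cylinder k r) = ennreal (pi * r\<^sup>2)"
    using c r(1) unfolding symplectic_capacity_def by blast+
  ultimately show ?thesis
    by (simp add: r(2) M_def)
qed

theorem proposition10:
  fixes X Y :: "real^'n::finite^'n" and hbar h :: real
  assumes "hbar > 0" and "h = 2 * pi * hbar"
    and "symmetric_matrix X" and "symmetric_matrix Y" and "positive_definite X"
  shows
    "represented_in_symplectic_coordinates (fermi_ellipsoid hbar X Y)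
       (\<lambda>x p. (X *v x) \<bullet> x + (X *v p) \<bullet> p \<le> hbar * trace X)
     \<and> (\<exists>lam. lists_eigenvalues X lam)
     \<and> (\<forall>lam. lists_eigenvalues X lam \<longrightarrow>
          represented_in_symplectic_coordinates (fermi_ellipsoid hbar X Y)
            (\<lambda>x p. (\<Sum>j\<in>UNIV. lam j * ((x $ j)\<^sup>2 + (p $ j)\<^sup>2)) \<le> hbar * trace X))
     \<and> (\<forall>c. symplectic_capacity c \<longrightarrow>
          c (fermi_ellipsoid hbar X Y) = ennreal (pi * trace X / largest_eigenvalue X * hbar)
          \<and> pi * trace X / largest_eigenvalue X * hbar \<ge> h / 2
          \<and> ennreal (h / 2) \<le> c (fermi_ellipsoid hbar X Y)
          \<and> c (fermi_ellipsoid hbar X Y) \<le> ennreal (real CARD('n) * h / 2))"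
proof -
  have tr: "0 < trace X"
    using assms(5) by (rule trace_positive_definite)
  obtain U0 d where U0: "orthogonal_matrix U0" "X = U0 ** diagonal_matrix d ** transpose U0"
    using symmetric_matrix_diagonalization[OF assms(3)] .
  then have ex: "lists_eigenvalues X d"
    using lists_eigenvalues_conj_diagonal by simp
  have rep2: "represented_in_symplectic_coordinates (fermi_ellipsoid hbar X Y)
        (\<lambda>x p. (\<Sum>j\<in>UNIV. lam j * ((x $ j)\<^sup>2 + (p $ j)\<^sup>2)) \<le> hbar * trace X)"
    if lam: "lists_eigenvalues X lam" for lam
  proof -
    obtain U where U: "orthogonal_matrix U" "X = U ** diagonal_matrix lam ** transpose U"
      using lists_eigenvalues_diagonalization[OF assms(3) lam] .
    note pos = lists_eigenvalues_pos[OF assms(5) lam]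
    let ?A = "diagonal_matrix (\<lambda>j. sqrt (lam j)) ** transpose U"
    let ?B = "U ** diagonal_matrix (\<lambda>j. 1 / sqrt (lam j))"
    \<comment> \<open>The factors are associated as \<open>diagonal_matrix_mult\<close> produces
      them, so that these equations rewrite the products below.\<close>
    have sqrt: "sqrt (lam j) * lam j * sqrt (lam j) = lam j * lam j"
      "1 / sqrt (lam j) * lam j * (1 / sqrt (lam j)) = 1" for j
      using pos[of j] by (simp_all add: real_sqrt_mult_self field_simps flip: power2_eq_square)
    have "?B ** ?A = mat 1"
    proof -
      have "?B ** ?A = U ** (diagonal_matrix (\<lambda>j. 1 / sqrt (lam j)) **
          diagonal_matrix (\<lambda>j. sqrt (lam j))) ** transpose U"
        by (simp add: matrix_mul_assoc)
      then show ?thesis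
        using U(1) less_imp_neq[OF pos]
        by (simp add: diagonal_matrix_mult diagonal_matrix_one orthogonal_matrix_def)
    qed
    then have "?A ** ?B = mat 1"
      by (simp add: matrix_left_right_inverse)
    moreover have "transpose ?A ** diagonal_matrix lam ** ?A = X ** X"
    proof -
      have "transpose ?A ** diagonal_matrix lam ** ?A = U ** (diagonal_matrix (\<lambda>j. sqrt (lam j)) **
          diagonal_matrix lam ** diagonal_matrix (\<lambda>j. sqrt (lam j))) ** transpose U"
        by (simp add: matrix_transpose_mul transpose_diagonal_matrix matrix_mul_assoc)
      then show ?thesis
        unfolding U(2) orthogonal_conj_mult[OF U(1)] diagonal_matrix_mult sqrt .
    qed
    moreover have "?B ** diagonal_matrix lam ** transpose ?B = mat 1"
    proof -
      have "?B ** diagonal_matrix lam ** transpose ?B = U ** (diagonal_matrix (\<lambda>j. 1 / sqrt (lam j)) **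
          diagonal_matrix lam ** diagonal_matrix (\<lambda>j. 1 / sqrt (lam j))) ** transpose U"
        by (simp add: matrix_transpose_mul transpose_diagonal_matrix matrix_mul_assoc)
      then show ?thesis
        using U(1) unfolding diagonal_matrix_mult sqrt
        by (simp add: diagonal_matrix_one orthogonal_matrix_def)
    qed
    ultimately have "represented_in_symplectic_coordinates (fermi_ellipsoid hbar X Y)
        (\<lambda>x p. (diagonal_matrix lam *v x) \<bullet> x + (diagonal_matrix lam *v p) \<bullet> p \<le> hbar * trace X)"
      by (rule fermi_ellipsoid_represented[OF assms(4) tr])
    then show ?thesis
      by (simp add: diagonal_matrix_mult_vec inner_vec_def power2_eq_square sum.distrib
          distrib_left mult.assoc)
  qed
  have rep1: "represented_in_symplectic_coordinates (fermi_ellipsoid hbar X Y)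
       (\<lambda>x p. (X *v x) \<bullet> x + (X *v p) \<bullet> p \<le> hbar * trace X)"
  proof (rule fermi_ellipsoid_represented[OF assms(4) tr])
    note pos = lists_eigenvalues_pos[OF assms(5) ex]
    \<comment> \<open>\<open>conj e\<close> replaces the eigenvalues \<open>d\<close> of
      \<open>X\<close> by \<open>e\<close> in the same eigenbasis. Products then act eigenvalue by
      eigenvalue, which gives the square root of \<open>X\<close> and its inverse.\<close>
    define conj where "conj e = U0 ** diagonal_matrix e ** transpose U0" for e
    have mult: "conj e ** conj f = conj (\<lambda>j. e j * f j)" for e f
      by (simp add: conj_def orthogonal_conj_mult[OF U0(1)] diagonal_matrix_mult)
    have trans: "transpose (conj e) = conj e" for e
      by (simp add: conj_def matrix_transpose_mul transpose_diagonal_matrix matrix_mul_assoc)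
    have X: "X = conj d"
      by (simp add: conj_def U0(2))
    have one: "conj (\<lambda>_. 1) = mat 1"
      using U0(1) by (simp add: conj_def diagonal_matrix_one orthogonal_matrix_def)
    have sqrt: "sqrt (d j) * (1 / sqrt (d j)) = 1" "sqrt (d j) * d j * sqrt (d j) = d j * d j"
      "1 / sqrt (d j) * d j * (1 / sqrt (d j)) = 1" for j
      using pos[of j] by (simp_all add: real_sqrt_mult_self field_simps flip: power2_eq_square)
    show "conj (\<lambda>j. sqrt (d j)) ** conj (\<lambda>j. 1 / sqrt (d j)) = mat 1"
      unfolding mult sqrt one ..
    show "transpose (conj (\<lambda>j. sqrt (d j))) ** X ** conj (\<lambda>j. sqrt (d j)) = X ** X"
      unfolding X trans mult sqrt ..
    show "conj (\<lambda>j. 1 / sqrt (d j)) ** X ** transpose (conj (\<lambda>j. 1 / sqrt (d j))) = mat 1"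
      unfolding X trans mult sqrt one ..
  qed
  let ?M = "largest_eigenvalue X"
  have M: "?M = Max (range d)"
    by (simp add: largest_eigenvalue_def lists_eigenvalues_range[OF ex])
  have d: "0 < d j" for j
    using lists_eigenvalues_pos[OF assms(5) ex] .
  have trd: "trace X = (\<Sum>j\<in>UNIV. d j)"
    using trace_conj_diagonal[OF U0(1), of d] U0(2) by simp
  have "?M \<in> range d"
    unfolding M by (rule Max_in) auto
  then obtain k where k: "?M = d k"
    by auto
  have Mpos: "0 < ?M"
    using d k by simp
  \<comment> \<open>All eigenvalues are positive, so one of them is at most their sum. This yields
    the bound \<open>h / 2\<close>; bounding each of them by the largest yields the upper
    bound.\<close>
  have lower: "?M \<le> trace X"
    unfolding k trd using d by (intro member_le_sum) (auto intro: less_imp_le)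
  have upper: "trace X \<le> real CARD('n) * ?M"
    unfolding trd M using sum_bounded_above[of UNIV d "Max (range d)"] by simp
  \<comment> \<open>The capacity is computed in the diagonal normal form, with
    \<open>E = hbar * trace X\<close>.\<close>
  have cap: "c (fermi_ellipsoid hbar X Y) = ennreal (pi * trace X / ?M * hbar)"
    if c: "symplectic_capacity c" for c
    using capacity_symplectic_coordinates[OF c rep2[OF ex]]
      capacity_weighted_ellipsoid[OF c d, of "hbar * trace X"] tr assms(1)
    by (simp add: M mult_ac)
  have ge: "h / 2 \<le> pi * trace X / ?M * hbar"
    using lower Mpos assms(1,2) by (simp add: field_simps)
  have le: "pi * trace X / ?M * hbar \<le> real CARD('n) * h / 2"
    using upper Mpos assms(1,2) by (simp add: field_simps)
  show ?thesis
    using rep1 rep2 ex cap ge ennreal_leI[OF ge] ennreal_leI[OF le]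
    by (intro conjI allI impI exI[of _ d]) (simp_all only:)
qed

end
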